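(* Let $m\in\mathbb{N}$. The sequence spaces $l_\infty^G(\Delta^m_G)$, $c^G(\Delta^m_G)$ and $c_0^G(\Delta^m_G)$ are Banach spaces (over $\mathbb{C}(G)$, in the geometric sense) with the norm $$\|x\|^G_{\Delta_G}={}_G\sum_{i=1}^m|x_i|^G\oplus\|\Delta^m_G x\|^G_\infty .$$
   Context: Geometric arithmetic: the map $z\mapsto e^z$ is used as a generator, i.e. it is treated as a bijection from $\mathbb{C}$ onto the set of geometric complex numbers $\mathbb{C}(G)=\{e^z:z\in\mathbb{C}\}$, with inverse $\ln$. Operations: $x\oplus y=e^{\ln x+\ln y}=xy$, $x\ominus y=e^{\ln x-\ln y}=x/y$, $x\odot y=e^{\ln x\cdot\ln y}$. With $\oplus,\odot$, $\mathbb{C}(G)$ is a field with zero $1$ and identity $e$. Geometric modulus: $|e^z|^G=e^{|z|}\in[1,\infty)$; such values are compared in the usual order of the reals. ${}_G\sum_{i=1}^n x_i=x_1\oplus\cdots\oplus x_n$. Geometric convergence $x_k\to x$ means $|x_k\ominus x|^G\to1$. $\mathbb{N}=\{1,2,\dots\}$. $\omega(G)$ is the set of all sequences $x=(x_k)_{k\ge1}$ in $\mathbb{C}(G)$, a vector space over $\mathbb{C}(G)$ with coordinatewise operations $(x_k)\oplus(y_k)=(x_k\oplus y_k)$ and $\alpha\odot(x_k)=(\alpha\odot x_k)$. Set $l_\infty^G=\{x\in\omega(G):\sup_k|x_k|^G<\infty\}$, $c^G=\{x\in\omega(G):|x_k\ominus l|^G\to1\text{ for some }l\in\mathbb{C}(G)\}$,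 $c_0^G=\{x\in\omega(G):|x_k|^G\to1\}$, and $\|x\|^G_\infty=\sup_k|x_k|^G$. Differences: $\Delta^0_Gx=x$, $\Delta_G^mx=(\Delta^m_Gx_k)_k$ with $\Delta^m_Gx_k=\Delta^{m-1}_Gx_k\ominus\Delta^{m-1}_Gx_{k+1}$. For $X\in\{l_\infty^G,c^G,c_0^G\}$, $X(\Delta^m_G)=\{x\in\omega(G):\Delta^m_Gx\in X\}$. A geometric norm takes values in $[1,\infty)$ and satisfies: $\|x\|^G=1$ iff $x=(1,1,\dots)$, $\|\alpha\odot x\|^G=|\alpha|^G\odot\|x\|^G$, $\|x\oplus y\|^G\le\|x\|^G\oplus\|y\|^G$. The space is a Banach space if every sequence $(x_n)$ with $\|x_n\ominus x_l\|^G\to1$ as $n,l\to\infty$ has a limit $x$ in the space, i.e. $\|x_n\ominus x\|^G\to1$. *)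

theory Defs
  imports Complex_Main "HOL-Library.Function_Algebras"
begin

text \<open>
  The complex exponential is not injective, whereas geometric arithmetic needs a generator with a
  genuine inverse. A geometric complex number is therefore the formal symbol
  \<open>e\<^sup>z\<close>, written \<open>GExp z\<close>, and \<open>gln\<close> is the inverse of the generator.
\<close>

datatype gcomplex = GExp (gln: complex)

text \<open>
  The class operations \<open>+\<close>, \<open>-\<close>, \<open>*\<close> on \<^typ>\<open>gcomplex\<close> are the geometric operations
  \<open>\<oplus>\<close>, \<open>\<ominus>\<close>, \<open>\<odot>\<close>. In particular the class constants \<open>0\<close> and \<open>1\<close> are the geometric zero
  \<open>e\<^sup>0\<close> (the number one) and the geometric identity \<open>e\<^sup>1\<close> (the number \<open>e\<close>).
\<close>

instantiation gcomplex :: field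
begin

definition "0 = GExp 0"
definition "1 = GExp 1"
definition "x + y = GExp (gln x + gln y)"
definition "x - y = GExp (gln x - gln y)"
definition "- x = GExp (- gln x)" for x :: gcomplex
definition "x * y = GExp (gln x * gln y)"
definition "inverse x = GExp (inverse (gln x))"
definition "x div y = GExp (gln x / gln y)" for x y :: gcomplex

instance
proof -
  have "gln a \<noteq> 0" if "a \<noteq> GExp 0" for a
    using that by (cases a) auto
  then show "OFCLASS(gcomplex, field_class)"
    by intro_classes
      (auto simp: zero_gcomplex_def one_gcomplex_def plus_gcomplex_def minus_gcomplex_def
        uminus_gcomplex_def times_gcomplex_def inverse_gcomplex_def divide_gcomplex_def
        algebra_simps divide_inverse right_inverse)
qed

end

definition gmod :: "gcomplex \<Rightarrow> real" where
  "gmod x = exp (cmod (gln x))"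

text \<open>
  Moduli and norms are ordinary real numbers in \<open>[1,\<infinity>)\<close>, so that they carry the usual order and
  topology. On positive reals the generator is the real exponential.
\<close>

definition gadd :: "real \<Rightarrow> real \<Rightarrow> real" (infixl \<open>\<oplus>\<^sub>G\<close> 65) where
  "a \<oplus>\<^sub>G b = exp (ln a + ln b)"

definition gmult :: "real \<Rightarrow> real \<Rightarrow> real" (infixl \<open>\<odot>\<^sub>G\<close> 70) where
  "a \<odot>\<^sub>G b = exp (ln a * ln b)"

primrec gsum :: "(nat \<Rightarrow> real) \<Rightarrow> nat \<Rightarrow> real" where
  "gsum f 0 = 1"
| "gsum f (Suc n) = gsum f n \<oplus>\<^sub>G f (Suc n)"

definition geometric_norm_on ::
  "(gcomplex \<Rightarrow> 'v \<Rightarrow> 'v) \<Rightarrow> 'v::ab_group_add set \<Rightarrow> ('v \<Rightarrow> real) \<Rightarrow> bool" where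
  "geometric_norm_on scale V N \<longleftrightarrow>
     (\<forall>x\<in>V. 1 \<le> N x) \<and>
     (\<forall>x\<in>V. N x = 1 \<longleftrightarrow> x = 0) \<and>
     (\<forall>\<alpha>. \<forall>x\<in>V. N (scale \<alpha> x) = gmod \<alpha> \<odot>\<^sub>G N x) \<and>
     (\<forall>x\<in>V. \<forall>y\<in>V. N (x + y) \<le> N x \<oplus>\<^sub>G N y)"

definition geometric_complete_on :: "'v::ab_group_add set \<Rightarrow> ('v \<Rightarrow> real) \<Rightarrow> bool" where
  "geometric_complete_on V N \<longleftrightarrow>
     (\<forall>X :: nat \<Rightarrow> 'v. range X \<subseteq> V \<longrightarrow>
        ((\<lambda>(n, l). N (X n - X l)) \<longlongrightarrow> 1) (sequentially \<times>\<^sub>F sequentially) \<longrightarrow>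
        (\<exists>x\<in>V. (\<lambda>n. N (X n - x)) \<longlonglongrightarrow> 1))"

definition geometric_banach_space ::
  "(gcomplex \<Rightarrow> 'v \<Rightarrow> 'v) \<Rightarrow> 'v::ab_group_add set \<Rightarrow> ('v \<Rightarrow> real) \<Rightarrow> bool" where
  "geometric_banach_space scale V N \<longleftrightarrow>
     vector_space scale \<and> module.subspace scale V \<and>
     geometric_norm_on scale V N \<and> geometric_complete_on V N"

text \<open>
  A sequence \<open>(x\<^sub>k)\<close>, \<open>k \<ge> 1\<close>, is a function on \<^typ>\<open>nat\<close> whose value at \<open>k\<close> is the term
  \<open>x\<^sub>k\<^sub>+\<^sub>1\<close>. Its pointwise additive structure comes from \<^theory>\<open>HOL-Library.Function_Algebras\<close>;
  its zero is the constant sequence \<open>e\<^sup>0\<close>.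
\<close>

type_synonym gseq = "nat \<Rightarrow> gcomplex"

definition gscale :: "gcomplex \<Rightarrow> gseq \<Rightarrow> gseq" where
  "gscale \<alpha> x = (\<lambda>k. \<alpha> * x k)"

definition linf_G :: "gseq set" where
  "linf_G = {x. bdd_above (range (\<lambda>k. gmod (x k)))}"

definition c_G :: "gseq set" where
  "c_G = {x. \<exists>l. (\<lambda>k. gmod (x k - l)) \<longlonglongrightarrow> 1}"

definition c0_G :: "gseq set" where
  "c0_G = {x. (\<lambda>k. gmod (x k)) \<longlonglongrightarrow> 1}"

definition norm_inf_G :: "gseq \<Rightarrow> real" where
  "norm_inf_G x = (SUP k. gmod (x k))"

primrec Delta_G :: "nat \<Rightarrow> gseq \<Rightarrow> gseq" where
  "Delta_G 0 x = x"
| "Delta_G (Suc m) x = (\<lambda>k. Delta_G m x k - Delta_G m x (Suc k))"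

definition diff_space :: "gseq set \<Rightarrow> nat \<Rightarrow> gseq set" where
  "diff_space X m = {x. Delta_G m x \<in> X}"

text \<open>The term \<open>x\<^sub>i\<close> of the mathematical sequence is \<open>x (i - 1)\<close>.\<close>

definition norm_Delta_G :: "nat \<Rightarrow> gseq \<Rightarrow> real" where
  "norm_Delta_G m x = gsum (\<lambda>i. gmod (x (i - 1))) m \<oplus>\<^sub>G norm_inf_G (Delta_G m x)"

end

theory Submission
  imports Defs
begin

text \<open>
  The logarithm turns the geometric norm into the ordinary norm
  \<open>\<Sum>\<^sub>i\<^sub><\<^sub>m \<bar>x\<^sub>i\<bar> + sup\<^sub>k \<bar>\<Delta>\<^sup>m x\<^sub>k\<bar>\<close> of complex sequences. Since \<open>\<Delta>\<^sup>m x\<close> and the first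
  \<open>m\<close> terms determine \<open>x\<close>, with each term depending boundedly on these data, the norm is definite
  and a Cauchy sequence converges coordinatewise; its \<open>m\<close>-th differences then converge uniformly.
  Hence \<open>X(\<Delta>\<^sup>m)\<close> is complete as soon as \<open>X\<close> is closed under uniform limits, which holds for
  bounded, convergent and null sequences alike.
\<close>

section \<open>Logarithmic coordinates\<close>

lemma gln_simps [simp]:
  "gln 0 = 0" "gln (x + y) = gln x + gln y" "gln (x - y) = gln x - gln y"
  "gln (x * y) = gln x * gln y"
  by (simp_all add: zero_gcomplex_def plus_gcomplex_def minus_gcomplex_def times_gcomplex_def)

lemma gln_eq_0_iff [simp]: "gln x = 0 \<longleftrightarrow> x = 0"
  by (cases x) (simp add: zero_gcomplex_def)

text \<open>Translates geometric convergence, measured by a modulus or norm tending to 1, into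
  ordinary convergence of its logarithm to 0.\<close>

lemma tendsto_exp_1_iff: "((\<lambda>x. exp (f x :: real)) \<longlongrightarrow> 1) F \<longleftrightarrow> (f \<longlongrightarrow> 0) F"
proof
  assume "((\<lambda>x. exp (f x)) \<longlongrightarrow> 1) F"
  then show "(f \<longlongrightarrow> 0) F" using tendsto_ln[of "\<lambda>x. exp (f x)" 1 F] by simp
next
  assume "(f \<longlongrightarrow> 0) F"
  then show "((\<lambda>x. exp (f x)) \<longlongrightarrow> 1) F" using tendsto_exp[of f 0 F] by simp
qed

lemma linf_G_iff: "x \<in> linf_G \<longleftrightarrow> (\<exists>B. \<forall>k. cmod (gln (x k)) \<le> B)"
proof
  assume "x \<in> linf_G"
  then obtain B where "\<And>k. exp (cmod (gln (x k))) \<le> B"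
    by (auto simp: linf_G_def bdd_above_def gmod_def)
  then have "cmod (gln (x k)) \<le> ln B" for k
    by (meson exp_gt_zero less_le_trans ln_ge_iff)
  then show "\<exists>B. \<forall>k. cmod (gln (x k)) \<le> B" by blast
next
  assume "\<exists>B. \<forall>k. cmod (gln (x k)) \<le> B"
  then obtain B where "\<And>k. cmod (gln (x k)) \<le> B" by blast
  then have "gmod (x k) \<le> exp B" for k by (simp add: gmod_def)
  then show "x \<in> linf_G" by (auto simp: linf_G_def bdd_above_def)
qed

lemma linf_G_bdd_above:
  assumes "x \<in> linf_G"
  shows "bdd_above (range (\<lambda>k. cmod (gln (x k))))"
  using assms by (auto simp: linf_G_iff intro: bdd_aboveI)

lemma c0_G_iff: "x \<in> c0_G \<longleftrightarrow> (\<lambda>k. gln (x k)) \<longlonglongrightarrow> 0"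
  by (simp add: c0_G_def gmod_def tendsto_exp_1_iff tendsto_norm_zero_iff)

lemma c_G_iff: "x \<in> c_G \<longleftrightarrow> convergent (\<lambda>k. gln (x k))"
proof -
  have "(\<lambda>k. gmod (x k - l)) \<longlonglongrightarrow> 1 \<longleftrightarrow> (\<lambda>k. gln (x k)) \<longlonglongrightarrow> gln l" for l
    by (simp add: gmod_def tendsto_exp_1_iff tendsto_norm_zero_iff LIM_zero_iff)
  \<comment> \<open>Any complex limit \<open>z\<close> of the logarithms equals
    \<open>gln (GExp z)\<close>, so it comes from a geometric limit.\<close>
  then show ?thesis
    by (auto simp: c_G_def convergent_def) (metis gcomplex.sel)
qed

lemma vector_space_gscale: "vector_space gscale"
  by unfold_locales (auto simp: gscale_def fun_eq_iff algebra_simps)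

interpretation gseq: vector_space gscale
  by (rule vector_space_gscale)

section \<open>Differences\<close>

lemma Delta_G_add: "Delta_G m (x + y) = Delta_G m x + Delta_G m y"
  by (induction m) (auto simp: fun_eq_iff)

lemma Delta_G_diff: "Delta_G m (x - y) = Delta_G m x - Delta_G m y"
  by (induction m) (auto simp: fun_eq_iff)

lemma Delta_G_0 [simp]: "Delta_G m 0 = 0"
  by (induction m) (auto simp: fun_eq_iff)

lemma Delta_G_gscale: "Delta_G m (gscale \<alpha> x) = gscale \<alpha> (Delta_G m x)"
  by (induction m) (auto simp: fun_eq_iff gscale_def algebra_simps)

text \<open>\<open>Delta_G\<close> takes the new difference last; taking the first difference first
  lets an induction on \<open>m\<close> pass from \<open>x\<close> to its difference
  sequence.\<close>

lemma Delta_G_Suc_inner: "Delta_G (Suc m) x = Delta_G m (\<lambda>k. x k - x (Suc k))"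
proof (induction m)
  case (Suc m)
  then show ?case by (metis Delta_G.simps(2))
qed simp

text \<open>Makes quantitative that the first \<open>m\<close> terms and the \<open>m\<close>-th
  differences determine \<open>x\<close>. The induction bounds the difference sequence
  \<open>y\<close> first and then recovers \<open>x\<close> from
  \<open>x (Suc k) = x k - y k\<close>. Each order costs a factor 2, and each step in
  \<open>k\<close> at most a factor 3.\<close>

lemma norm_term_le:
  assumes "\<And>i. i < m \<Longrightarrow> cmod (gln (x i)) \<le> B" "\<And>k. cmod (gln (Delta_G m x k)) \<le> B"
  shows "cmod (gln (x k)) \<le> 2 ^ m * 3 ^ k * B"
  using assms
proof (induction m arbitrary: x B k)
  case 0
  have "0 \<le> B" using 0(2)[of 0] norm_ge_zero order_trans by blast
  then have "1 * B \<le> 3 ^ k * B" by (intro mult_right_mono) auto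
  then show ?case using 0(2)[of k] by simp
next
  case (Suc m)
  have B: "0 \<le> B" using Suc.prems(1)[of 0] norm_ge_zero order_trans by blast
  define y where "y k = x k - x (Suc k)" for k
  have "cmod (gln (y i)) \<le> 2 * B" if "i < m" for i
    using Suc.prems(1)[of i] Suc.prems(1)[of "Suc i"] that
      norm_triangle_ineq4[of "gln (x i)" "gln (x (Suc i))"] by (simp add: y_def)
  \<comment> \<open>This is the difference of order \<open>Suc m\<close> of \<open>x\<close>,
    bounded by \<open>B\<close>; the bound is relaxed to \<open>2 * B\<close> to share one constant
    with the initial terms of \<open>y\<close>.\<close>
  moreover have "cmod (gln (Delta_G m y i)) \<le> 2 * B" for i
    using Suc.prems(2)[of i] B unfolding Delta_G_Suc_inner y_def[abs_def] by simp
  ultimately have y: "cmod (gln (y k)) \<le> 2 ^ m * 3 ^ k * (2 * B)" for k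
    by (rule Suc.IH)
  show ?case
  proof (induction k)
    case 0
    have "1 * B \<le> 2 ^ Suc m * B"
      using B by (intro mult_right_mono one_le_power) auto
    then show ?case using Suc.prems(1)[of 0] by simp
  next
    case (Suc k)
    have "cmod (gln (x (Suc k))) \<le> cmod (gln (x k)) + cmod (gln (y k))"
      using norm_triangle_ineq4[of "gln (x k)" "gln (y k)"] by (simp add: y_def)
    also have "\<dots> \<le> 2 ^ Suc m * 3 ^ k * B + 2 ^ m * 3 ^ k * (2 * B)"
      using Suc y by (intro add_mono) auto
    also have "\<dots> \<le> 2 ^ Suc m * 3 ^ Suc k * B"
      using B by (simp add: algebra_simps)
    finally show ?case .
  qed
qed

lemma tendsto_gln_Delta_G:
  assumes "\<And>k. (\<lambda>n. gln (X n k)) \<longlonglongrightarrow> gln (x k)"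
  shows "(\<lambda>n. gln (Delta_G m (X n) k)) \<longlonglongrightarrow> gln (Delta_G m x k)"
  by (induction m arbitrary: k) (auto intro: assms tendsto_diff)

section \<open>The logarithm of the norm\<close>

text \<open>The supremum is a real one and is meaningful only for bounded differences, whence the
  recurring hypothesis \<open>Delta_G m x \<in> linf_G\<close>.\<close>

definition lnorm :: "nat \<Rightarrow> gseq \<Rightarrow> real" where
  "lnorm m x = (\<Sum>i<m. cmod (gln (x i))) + (SUP k. cmod (gln (Delta_G m x k)))"

lemma gsum_gmod: "gsum (\<lambda>i. gmod (x (i - 1))) m = exp (\<Sum>i<m. cmod (gln (x i)))"
  by (induction m) (auto simp: gadd_def gmod_def)

text \<open>The exponential is monotone and continuous, so it commutes with the supremum of a
  nonempty bounded set.\<close>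

lemma norm_Delta_G_eq:
  assumes "Delta_G m x \<in> linf_G"
  shows "norm_Delta_G m x = exp (lnorm m x)"
proof -
  let ?S = "range (\<lambda>k. cmod (gln (Delta_G m x k)))"
  have "exp (Sup ?S) = (SUP s\<in>?S. exp s)"
    using assms
    by (intro continuous_at_Sup_mono continuous_intros)
      (auto simp: linf_G_bdd_above mono_def)
  then have "norm_inf_G (Delta_G m x) = exp (Sup ?S)"
    by (simp add: norm_inf_G_def gmod_def image_image)
  then show ?thesis by (simp add: norm_Delta_G_def gsum_gmod gadd_def lnorm_def del: One_nat_def)
qed

text \<open>Together with \<open>lnorm_leI\<close> this says that \<open>lnorm\<close> is the least
  upper bound of these expressions over \<open>k\<close>, so later estimates can be made
  termwise.\<close>

lemma sum_add_norm_le_lnorm: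
  assumes "Delta_G m x \<in> linf_G"
  shows "(\<Sum>i<m. cmod (gln (x i))) + cmod (gln (Delta_G m x k)) \<le> lnorm m x"
  unfolding lnorm_def using linf_G_bdd_above[OF assms] by (auto intro: cSUP_upper)

lemma lnorm_leI:
  assumes "\<And>k. (\<Sum>i<m. cmod (gln (x i))) + cmod (gln (Delta_G m x k)) \<le> B"
  shows "lnorm m x \<le> B"
proof -
  have "(SUP k. cmod (gln (Delta_G m x k))) \<le> B - (\<Sum>i<m. cmod (gln (x i)))"
    using assms by (intro cSUP_least) (auto simp: le_diff_eq add.commute)
  then show ?thesis by (simp add: lnorm_def)
qed

lemma lnorm_nonneg:
  assumes "Delta_G m x \<in> linf_G"
  shows "0 \<le> lnorm m x"
proof -
  have "0 \<le> (\<Sum>i<m. cmod (gln (x i))) + cmod (gln (Delta_G m x 0))"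
    by (simp add: sum_nonneg)
  then show ?thesis using sum_add_norm_le_lnorm[OF assms] order_trans by blast
qed

text \<open>Continuity of the coordinate maps: it yields definiteness of the norm and coordinatewise
  Cauchy sequences.\<close>

lemma norm_term_le_lnorm:
  assumes "Delta_G m x \<in> linf_G"
  shows "cmod (gln (x k)) \<le> 2 ^ m * 3 ^ k * lnorm m x"
proof (rule norm_term_le)
  fix i assume "i < m"
  then have "cmod (gln (x i)) \<le> (\<Sum>i<m. cmod (gln (x i)))"
    by (intro member_le_sum) auto
  then show "cmod (gln (x i)) \<le> lnorm m x"
    using sum_add_norm_le_lnorm[OF assms, of 0] norm_ge_zero[of "gln (Delta_G m x 0)"]
    by linarith
next
  fix k
  have "0 \<le> (\<Sum>i<m. cmod (gln (x i)))" by (simp add: sum_nonneg)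
  then show "cmod (gln (Delta_G m x k)) \<le> lnorm m x"
    using sum_add_norm_le_lnorm[OF assms, of k] by linarith
qed

lemma lnorm_eq_0_iff:
  assumes "Delta_G m x \<in> linf_G"
  shows "lnorm m x = 0 \<longleftrightarrow> x = 0"
proof
  assume "lnorm m x = 0"
  then show "x = 0" using norm_term_le_lnorm[OF assms] by (auto simp: fun_eq_iff)
qed (simp add: lnorm_def)

lemma lnorm_gscale:
  assumes "Delta_G m x \<in> linf_G"
  shows "lnorm m (gscale \<alpha> x) = cmod (gln \<alpha>) * lnorm m x"
proof -
  let ?S = "range (\<lambda>k. cmod (gln (Delta_G m x k)))"
  \<comment> \<open>Multiplication by a nonnegative constant is monotone and continuous; this covers
    a zero scalar without a case split.\<close>
  have "cmod (gln \<alpha>) * Sup ?S = (SUP s\<in>?S. cmod (gln \<alpha>) * s)"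
    using assms
    by (intro continuous_at_Sup_mono continuous_intros)
      (auto simp: linf_G_bdd_above mono_def mult_left_mono)
  moreover have "Delta_G m (gscale \<alpha> x) k = \<alpha> * Delta_G m x k" for k
    by (simp add: Delta_G_gscale) (simp add: gscale_def)
  moreover have "gln (gscale \<alpha> x k) = gln \<alpha> * gln (x k)" for k
    by (simp add: gscale_def)
  ultimately show ?thesis
    by (simp add: lnorm_def norm_mult image_image sum_distrib_left distrib_left)
qed

lemma lnorm_add_le:
  assumes "Delta_G m x \<in> linf_G" "Delta_G m y \<in> linf_G"
  shows "lnorm m (x + y) \<le> lnorm m x + lnorm m y"
proof (rule lnorm_leI)
  fix k
  have "(\<Sum>i<m. cmod (gln ((x + y) i)))
      \<le> (\<Sum>i<m. cmod (gln (x i))) + (\<Sum>i<m. cmod (gln (y i)))"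
    by (simp add: norm_triangle_ineq sum_mono flip: sum.distrib)
  moreover have "cmod (gln (Delta_G m (x + y) k))
      \<le> cmod (gln (Delta_G m x k)) + cmod (gln (Delta_G m y k))"
    by (simp add: Delta_G_add norm_triangle_ineq)
  ultimately show "(\<Sum>i<m. cmod (gln ((x + y) i))) + cmod (gln (Delta_G m (x + y) k))
      \<le> lnorm m x + lnorm m y"
    using sum_add_norm_le_lnorm[OF assms(1), of k] sum_add_norm_le_lnorm[OF assms(2), of k]
    by linarith
qed

section \<open>Difference spaces of uniformly closed spaces\<close>

text \<open>Closedness in the sup metric of the logarithms, stated by approximation;
  \<open>y\<close> ranges over all sequences, so membership of a limit need not be known
  beforehand.\<close>

definition uniformly_closed :: "gseq set \<Rightarrow> bool" where
  "uniformly_closed S \<longleftrightarrow>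
     (\<forall>y. (\<forall>e>0. \<exists>x\<in>S. \<forall>k. cmod (gln (x k) - gln (y k)) \<le> e) \<longrightarrow> y \<in> S)"

lemma subspace_diff_space:
  assumes "gseq.subspace S"
  shows "gseq.subspace (diff_space S m)"
  using assms by (auto simp: gseq.subspace_def diff_space_def Delta_G_add Delta_G_gscale)

lemma geometric_norm_on_diff_space:
  assumes "S \<subseteq> linf_G" "gseq.subspace S"
  shows "geometric_norm_on gscale (diff_space S m) (norm_Delta_G m)"
proof -
  have S: "x \<in> S \<Longrightarrow> x \<in> linf_G" for x using assms by auto
  \<comment> \<open>Sums and multiples must have bounded differences before
    \<open>norm_Delta_G_eq\<close> can rewrite their norms.\<close>
  have V: "x + y \<in> S" "gscale \<alpha> x \<in> S" if "x \<in> S" "y \<in> S" for x y \<alpha>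
    using assms(2) that by (auto simp: gseq.subspace_def)
  show ?thesis
    using S V unfolding geometric_norm_on_def gadd_def gmult_def gmod_def
    by (auto simp: diff_space_def norm_Delta_G_eq lnorm_nonneg lnorm_eq_0_iff Delta_G_add
        Delta_G_gscale lnorm_gscale lnorm_add_le)
qed

lemma geometric_complete_on_diff_space:
  assumes S: "S \<subseteq> linf_G" "gseq.subspace S" "uniformly_closed S"
  shows "geometric_complete_on (diff_space S m) (norm_Delta_G m)"
  unfolding geometric_complete_on_def
proof (intro allI impI)
  fix X :: "nat \<Rightarrow> gseq"
  assume X: "range X \<subseteq> diff_space S m"
    and lim: "((\<lambda>(n, l). norm_Delta_G m (X n - X l)) \<longlongrightarrow> 1) (sequentially \<times>\<^sub>F sequentially)"
  have linf: "Delta_G m (x - y) \<in> linf_G"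
    if "x \<in> diff_space S m" "y \<in> diff_space S m" for x y
    using that S gseq.subspace_diff[OF S(2)] by (auto simp: diff_space_def Delta_G_diff)
  have linfX: "Delta_G m (X n - X l) \<in> linf_G" for n l using X linf by blast
  have lim0: "((\<lambda>p. lnorm m (X (fst p) - X (snd p))) \<longlongrightarrow> 0) (sequentially \<times>\<^sub>F sequentially)"
    using lim by (simp add: norm_Delta_G_eq[OF linfX] tendsto_exp_1_iff case_prod_unfold)
  have Cauchy_X: "\<exists>M. \<forall>n\<ge>M. \<forall>l\<ge>M. lnorm m (X n - X l) < e" if "e > 0" for e
    using order_tendstoD(2)[OF lim0 that] by (auto simp: eventually_prod_sequentially)
  have "Cauchy (\<lambda>n. gln (X n k))" for k
  proof (rule metric_CauchyI)
    fix e :: real assume "e > 0"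
    \<comment> \<open>The index \<open>k\<close> is fixed here, so the tolerance may absorb the
      constant of \<open>norm_term_le_lnorm\<close>.\<close>
    then have "e / (2 ^ m * 3 ^ k) > 0" by simp
    then obtain M where M: "\<And>n l. n \<ge> M \<Longrightarrow> l \<ge> M \<Longrightarrow> lnorm m (X n - X l) < e / (2 ^ m * 3 ^ k)"
      using Cauchy_X by blast
    have "dist (gln (X n k)) (gln (X l k)) < e" if "n \<ge> M" "l \<ge> M" for n l
    proof -
      have "2 ^ m * 3 ^ k * lnorm m (X n - X l) < e"
        using M[OF that] by (simp add: field_simps)
      then show ?thesis
        using norm_term_le_lnorm[OF linfX, of n l k] by (simp add: dist_norm)
    qed
    then show "\<exists>M. \<forall>n\<ge>M. \<forall>l\<ge>M. dist (gln (X n k)) (gln (X l k)) < e" by blast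
  qed
  then have "\<exists>z. (\<lambda>n. gln (X n k)) \<longlonglongrightarrow> z" for k
    by (simp add: Cauchy_convergent_iff convergent_def)
  then obtain z where z: "\<And>k. (\<lambda>n. gln (X n k)) \<longlonglongrightarrow> z k" by metis
  define x where "x k = GExp (z k)" for k
  have x: "(\<lambda>n. gln (X n k)) \<longlonglongrightarrow> gln (x k)" for k using z by (simp add: x_def)
  \<comment> \<open>Letting \<open>l\<close> tend to infinity in the Cauchy estimate for
    \<open>X n - X l\<close> preserves the weak inequality, as only finitely many coordinates enter
    for each \<open>k\<close>. The threshold \<open>M\<close> comes from the norm and hence does not
    depend on \<open>k\<close>.\<close>
  have uniform: "\<exists>M. \<forall>n\<ge>M. \<forall>k.
      (\<Sum>i<m. cmod (gln ((X n - x) i))) + cmod (gln (Delta_G m (X n - x) k)) \<le> e"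
    if "e > 0" for e
  proof -
    obtain M where M: "\<And>n l. n \<ge> M \<Longrightarrow> l \<ge> M \<Longrightarrow> lnorm m (X n - X l) < e"
      using Cauchy_X[OF \<open>e > 0\<close>] by blast
    have "(\<Sum>i<m. cmod (gln ((X n - x) i))) + cmod (gln (Delta_G m (X n - x) k)) \<le> e"
      if "n \<ge> M" for n k
    proof (rule LIMSEQ_le_const2)
      show "(\<lambda>l. (\<Sum>i<m. cmod (gln ((X n - X l) i))) + cmod (gln (Delta_G m (X n - X l) k)))
          \<longlonglongrightarrow> (\<Sum>i<m. cmod (gln ((X n - x) i))) + cmod (gln (Delta_G m (X n - x) k))"
        by (auto simp: Delta_G_diff intro!: tendsto_intros x tendsto_gln_Delta_G)
      have "(\<Sum>i<m. cmod (gln ((X n - X l) i))) + cmod (gln (Delta_G m (X n - X l) k)) \<le> e"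
        if "l \<ge> M" for l
        using sum_add_norm_le_lnorm[OF linfX, of n l k] M[OF \<open>n \<ge> M\<close> that] by linarith
      then show "\<exists>N. \<forall>l\<ge>N. (\<Sum>i<m. cmod (gln ((X n - X l) i)))
          + cmod (gln (Delta_G m (X n - X l) k)) \<le> e" by blast
    qed
    then show ?thesis by blast
  qed
  \<comment> \<open>Dropping the nonnegative sum from the estimate shows that the members
    \<open>Delta_G m (X M)\<close> of \<open>S\<close> approximate \<open>Delta_G m x\<close>
    uniformly.\<close>
  have "Delta_G m x \<in> S"
  proof -
    have "\<exists>y\<in>S. \<forall>k. cmod (gln (y k) - gln (Delta_G m x k)) \<le> e" if "e > 0" for e
    proof -
      obtain M where M: "\<And>k.
          (\<Sum>i<m. cmod (gln ((X M - x) i))) + cmod (gln (Delta_G m (X M - x) k)) \<le> e"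
        using uniform[OF \<open>e > 0\<close>] by blast
      have "0 \<le> (\<Sum>i<m. cmod (gln ((X M - x) i)))" by (intro sum_nonneg) auto
      then have "cmod (gln (Delta_G m (X M) k) - gln (Delta_G m x k)) \<le> e" for k
        using M[of k] by (simp add: Delta_G_diff)
      moreover have "Delta_G m (X M) \<in> S" using X by (auto simp: diff_space_def)
      ultimately show ?thesis by blast
    qed
    then show ?thesis using S(3) unfolding uniformly_closed_def by blast
  qed
  then have xV: "x \<in> diff_space S m" by (simp add: diff_space_def)
  have linfx: "Delta_G m (X n - x) \<in> linf_G" for n using X xV linf by blast
  have "(\<lambda>n. lnorm m (X n - x)) \<longlonglongrightarrow> 0"
  proof (rule LIMSEQ_I)
    fix e :: real assume "e > 0"
    \<comment> \<open>Passing to the supremum only gives a weak inequality, so \<open>e / 2\<close>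
      leaves room for the strict one.\<close>
    then obtain M where M: "\<And>n k. n \<ge> M \<Longrightarrow>
        (\<Sum>i<m. cmod (gln ((X n - x) i))) + cmod (gln (Delta_G m (X n - x) k)) \<le> e / 2"
      using uniform[of "e / 2"] by auto
    have "norm (lnorm m (X n - x) - 0) < e" if "n \<ge> M" for n
    proof -
      have "lnorm m (X n - x) \<le> e / 2" by (rule lnorm_leI) (rule M[OF that])
      with \<open>e > 0\<close> have "lnorm m (X n - x) < e" by linarith
      with lnorm_nonneg[OF linfx[of n]] show ?thesis by (simp del: minus_apply)
    qed
    then show "\<exists>M. \<forall>n\<ge>M. norm (lnorm m (X n - x) - 0) < e" by blast
  qed
  then have "(\<lambda>n. norm_Delta_G m (X n - x)) \<longlonglongrightarrow> 1"
    by (simp add: norm_Delta_G_eq[OF linfx] tendsto_exp_1_iff)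
  with xV show "\<exists>x\<in>diff_space S m. (\<lambda>n. norm_Delta_G m (X n - x)) \<longlonglongrightarrow> 1" by blast
qed

lemma geometric_banach_space_diff_space:
  assumes "S \<subseteq> linf_G" "gseq.subspace S" "uniformly_closed S"
  shows "geometric_banach_space gscale (diff_space S m) (norm_Delta_G m)"
  unfolding geometric_banach_space_def
  using assms
  by (intro conjI vector_space_gscale subspace_diff_space geometric_norm_on_diff_space
      geometric_complete_on_diff_space)

section \<open>Bounded, convergent and null sequences\<close>

lemma subspace_linf_G: "gseq.subspace linf_G"
proof -
  have "x + y \<in> linf_G" if xy: "x \<in> linf_G" "y \<in> linf_G" for x y
  proof -
    obtain A B where "\<And>k. cmod (gln (x k)) \<le> A" "\<And>k. cmod (gln (y k)) \<le> B"
      using xy unfolding linf_G_iff by blast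
    then have "cmod (gln ((x + y) k)) \<le> A + B" for k
      by (simp add: norm_triangle_mono)
    then show ?thesis unfolding linf_G_iff by blast
  qed
  moreover have "gscale \<alpha> x \<in> linf_G" if x: "x \<in> linf_G" for \<alpha> x
  proof -
    obtain A where "\<And>k. cmod (gln (x k)) \<le> A"
      using x unfolding linf_G_iff by blast
    then have "cmod (gln (gscale \<alpha> x k)) \<le> cmod (gln \<alpha>) * A" for k
      by (simp add: gscale_def norm_mult mult_left_mono)
    then show ?thesis unfolding linf_G_iff by blast
  qed
  moreover have "0 \<in> linf_G" by (auto simp: linf_G_iff)
  ultimately show ?thesis by (simp add: gseq.subspace_def)
qed

lemma subspace_c_G: "gseq.subspace c_G"
  by (auto simp: gseq.subspace_def c_G_iff gscale_def convergent_const
      intro: convergent_add convergent_mult)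

lemma subspace_c0_G: "gseq.subspace c0_G"
  by (auto simp: gseq.subspace_def c0_G_iff gscale_def intro: tendsto_add_zero tendsto_mult_right_zero)

lemma c_G_subset_linf_G: "c_G \<subseteq> linf_G"
proof
  fix x assume "x \<in> c_G"
  then have "Bseq (\<lambda>k. gln (x k))" by (simp add: c_G_iff convergent_imp_Bseq)
  then show "x \<in> linf_G" unfolding linf_G_iff by (rule BseqE) blast
qed

lemma c0_G_subset_c_G: "c0_G \<subseteq> c_G"
  by (auto simp: c0_G_iff c_G_iff convergent_def)

lemma uniformly_closed_linf_G: "uniformly_closed linf_G"
  unfolding uniformly_closed_def
proof (intro allI impI)
  fix y :: gseq
  assume "\<forall>e>0. \<exists>x\<in>linf_G. \<forall>k. cmod (gln (x k) - gln (y k)) \<le> e"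
  \<comment> \<open>One bounded approximant within distance 1 already bounds
    \<open>y\<close>.\<close>
  then obtain x where x: "x \<in> linf_G" "\<And>k. cmod (gln (x k) - gln (y k)) \<le> 1"
    using zero_less_one by blast
  then obtain B where B: "\<And>k. cmod (gln (x k)) \<le> B"
    unfolding linf_G_iff by blast
  have "cmod (gln (y k)) \<le> B + 1" for k
    using B[of k] x(2)[of k] norm_triangle_sub[of "gln (y k)" "gln (x k)"]
    by (simp add: norm_minus_commute)
  then show "y \<in> linf_G" unfolding linf_G_iff by blast
qed

text \<open>The Cauchy criterion avoids following the limits of the approximants: two distances to
  an approximant and one within its tail each contribute a third of \<open>e\<close>.\<close>

lemma uniformly_closed_c_G: "uniformly_closed c_G"
  unfolding uniformly_closed_def
proof (intro allI impI)
  fix y :: gseq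
  assume y: "\<forall>e>0. \<exists>x\<in>c_G. \<forall>k. cmod (gln (x k) - gln (y k)) \<le> e"
  have "Cauchy (\<lambda>k. gln (y k))"
  proof (rule metric_CauchyI)
    fix e :: real assume "e > 0"
    then obtain x where x: "x \<in> c_G" "\<And>k. cmod (gln (x k) - gln (y k)) \<le> e / 3"
      using y by (metis divide_pos_pos zero_less_numeral)
    have "Cauchy (\<lambda>k. gln (x k))" using x(1) by (simp add: c_G_iff Cauchy_convergent_iff)
    from metric_CauchyD[OF this, of "e / 3"]
    obtain M where M: "\<And>i j. i \<ge> M \<Longrightarrow> j \<ge> M \<Longrightarrow> dist (gln (x i)) (gln (x j)) < e / 3"
      using \<open>e > 0\<close> by auto
    have "dist (gln (y i)) (gln (y j)) < e" if "i \<ge> M" "j \<ge> M" for i j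
    proof -
      have xy: "dist (gln (x k)) (gln (y k)) \<le> e / 3" for k using x(2) by (simp add: dist_norm)
      show ?thesis
        using M[OF that] xy[of i] xy[of j] dist_triangle[of "gln (y i)" "gln (y j)" "gln (x i)"]
          dist_triangle[of "gln (x i)" "gln (y j)" "gln (x j)"]
          dist_commute[of "gln (y i)" "gln (x i)"] by linarith
    qed
    then show "\<exists>M. \<forall>i\<ge>M. \<forall>j\<ge>M. dist (gln (y i)) (gln (y j)) < e" by blast
  qed
  then show "y \<in> c_G" by (simp add: c_G_iff Cauchy_convergent_iff)
qed

lemma uniformly_closed_c0_G: "uniformly_closed c0_G"
  unfolding uniformly_closed_def
proof (intro allI impI)
  fix y :: gseq
  assume y: "\<forall>e>0. \<exists>x\<in>c0_G. \<forall>k. cmod (gln (x k) - gln (y k)) \<le> e"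
  have "(\<lambda>k. gln (y k)) \<longlonglongrightarrow> 0"
  proof (rule LIMSEQ_I)
    fix e :: real assume "e > 0"
    \<comment> \<open>Half of \<open>e\<close> goes to the distance from a null sequence, the other
      half to the tail of that sequence.\<close>
    then obtain x where x: "x \<in> c0_G" "\<And>k. cmod (gln (x k) - gln (y k)) \<le> e / 2"
      using y by (meson half_gt_zero)
    from x(1) have "(\<lambda>k. gln (x k)) \<longlonglongrightarrow> 0" by (simp add: c0_G_iff)
    from LIMSEQ_D[OF this, of "e / 2"] obtain M where M: "\<And>k. k \<ge> M \<Longrightarrow> cmod (gln (x k)) < e / 2"
      using \<open>e > 0\<close> by auto
    have "norm (gln (y k) - 0) < e" if "k \<ge> M" for k
      using M[OF that] x(2)[of k] norm_triangle_sub[of "gln (y k)" "gln (x k)"]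
      by (simp add: norm_minus_commute)
    then show "\<exists>M. \<forall>k\<ge>M. norm (gln (y k) - 0) < e" by blast
  qed
  then show "y \<in> c0_G" by (simp add: c0_G_iff)
qed

theorem theorem2p1:
  fixes m :: nat
  assumes "m \<ge> 1"
  shows "geometric_banach_space gscale (diff_space linf_G m) (norm_Delta_G m)
       \<and> geometric_banach_space gscale (diff_space c_G m) (norm_Delta_G m)
       \<and> geometric_banach_space gscale (diff_space c0_G m) (norm_Delta_G m)"
proof (intro conjI)
  show "geometric_banach_space gscale (diff_space linf_G m) (norm_Delta_G m)"
    by (rule geometric_banach_space_diff_space[OF subset_refl subspace_linf_G
          uniformly_closed_linf_G])
  show "geometric_banach_space gscale (diff_space c_G m) (norm_Delta_G m)"
    by (rule geometric_banach_space_diff_space[OF c_G_subset_linf_G subspace_c_G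
          uniformly_closed_c_G])
  show "geometric_banach_space gscale (diff_space c0_G m) (norm_Delta_G m)"
    by (rule geometric_banach_space_diff_space[OF subset_trans[OF c0_G_subset_c_G
          c_G_subset_linf_G] subspace_c0_G uniformly_closed_c0_G])
qed

end
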